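(* Let $2\le d<+\infty$ and let $\boldsymbol{S}=\{\mathrm{S}_1,\mathrm{S}_2\}$ be an arbitrary pair of real $d\times d$ matrices. If one of $\mathrm{S}_1$ and $\mathrm{S}_2$ has rank $1$, then $\boldsymbol{S}$ has the spectral finiteness property; that is, there exist a finite $n\ge 1$ and a word $(i_1,\ldots,i_n)\in\{1,2\}^n$ such that $$\rho(\boldsymbol{S})=\sqrt[n]{\rho(\mathrm{S}_{i_1}\cdots\mathrm{S}_{i_n})}.$$
   Context: For a square real matrix $A$, $\rho(A)$ denotes its usual spectral radius (largest modulus of a complex eigenvalue). For a pair $\boldsymbol{S}=\{\mathrm{S}_1,\mathrm{S}_2\}\subset\mathbb{R}^{d\times d}$, the generalized spectral radius is $$\rho(\boldsymbol{S})=\limsup_{n\to+\infty}\left\{\max_{(i_1,\ldots,i_n)\in\{1,2\}^n}\sqrt[n]{\rho(\mathrm{S}_{i_1}\cdots\mathrm{S}_{i_n})}\right\}.$$ *)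

theory Defs
  imports
    "HOL-Library.Extended_Real"
    "Jordan_Normal_Form.Spectral_Radius"
    "Jordan_Normal_Form.DL_Rank"
begin

definition real_spectral_radius :: "real mat \<Rightarrow> real" where
  "real_spectral_radius A = spectral_radius (map_mat complex_of_real A)"

text \<open>A pair of matrices is a function \<open>S\<close> on \<open>nat\<close> of which only the values \<open>S 1\<close> and
  \<open>S 2\<close> are used.\<close>

definition words :: "nat \<Rightarrow> nat list set" where
  "words n = {w. length w = n \<and> set w \<subseteq> {1, 2}}"

definition word_prod :: "nat \<Rightarrow> (nat \<Rightarrow> real mat) \<Rightarrow> nat list \<Rightarrow> real mat" where
  "word_prod d S w = foldr (\<lambda>i P. S i * P) w (1\<^sub>m d)"

text \<open>The limit superior is taken in \<open>ereal\<close>, since \<open>real\<close> is not a complete lattice. The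
  term for \<open>n = 0\<close> (where \<open>root 0 x = 0\<close>) does not affect its value.\<close>

definition generalized_spectral_radius :: "nat \<Rightarrow> (nat \<Rightarrow> real mat) \<Rightarrow> ereal" where
  "generalized_spectral_radius d S =
     limsup (\<lambda>n. ereal (Max ((\<lambda>w. root n (real_spectral_radius (word_prod d S w))) ` words n)))"

end

theory Submission
  imports Defs
begin

text \<open>Let \<open>A\<close> be the matrix of rank one and \<open>B\<close> the other one, and write \<open>A = U V\<close> with a column
  \<open>U\<close> and a row \<open>V\<close>. Since \<open>\<rho> (X Y) = \<rho> (Y X)\<close>, a word that contains \<open>A\<close> may be rotated so that
  it starts with \<open>A\<close>, and then the product \<open>U V W\<close> has the spectral radius of the \<open>1 \<times> 1\<close> matrix
  \<open>V W U\<close>. Every further letter \<open>A = U V\<close> in \<open>W\<close> splits this scalar, so the spectral radius of a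
  word \<open>A B\<^bsup>k\<^esup> A B\<^bsup>l\<^esup> \<dots>\<close> is \<open>c k * c l * \<dots>\<close> with \<open>c k = \<bar>V B\<^bsup>k\<^esup> U\<bar> = \<rho> (A B\<^bsup>k\<^esup>)\<close>. Its normalised
  root is thus a weighted geometric mean of the numbers \<open>root (k + 1) (c k)\<close>, and the generalized
  spectral radius is the supremum of \<open>\<rho> B\<close> and of these numbers.

  This supremum is attained. Indeed \<open>c k\<close> grows at most like \<open>s\<^bsup>k\<^esup>\<close> for each \<open>s > \<rho> B\<close>, so if some
  root exceeds \<open>\<rho> B\<close>, only finitely many roots are at least as large as that one, and one of them is
  the largest (\<open>max_root_attained\<close>). The maximising word is \<open>B\<close> or some \<open>A B\<^bsup>k\<^esup>\<close>; its powers show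
  that the limit superior is not smaller than the maximum
  (\<open>generalized_spectral_radius_eqI\<close>), and \<open>rank_1_word_bound\<close> shows that it is not larger.\<close>

section \<open>The spectral radius of a complex matrix\<close>

lemma eigenvalue_norm_le_spectral_radius:
  assumes A: "A \<in> carrier_mat n n" and ev: "eigenvalue A x"
  shows "norm x \<le> spectral_radius A"
  using spectral_radius_mem_max(2)[OF A eigenvalue_imp_nonzero_dim[OF A ev], of "norm x"] ev
  by (simp add: spectrum_def)

lemma spectral_radius_attained:
  assumes A: "A \<in> carrier_mat n n" and n: "n > 0"
  obtains x where "eigenvalue A x" and "norm x = spectral_radius A"
  using spectral_radius_mem_max(1)[OF A n] by (auto simp: spectrum_def)

lemma spectral_radius_nonneg:
  assumes A: "A \<in> carrier_mat n n" and n: "n > 0"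
  shows "0 \<le> spectral_radius A"
  using spectral_radius_attained[OF A n] by (metis norm_ge_zero)

lemma mult_mat_vec_zero:
  fixes X :: "'a :: semiring_0 mat"
  assumes "X \<in> carrier_mat n m"
  shows "X *\<^sub>v 0\<^sub>v m = 0\<^sub>v n"
  using assms by (intro eq_vecI) (auto intro: scalar_prod_right_zero)

lemma eigenvalue_mult_commute:
  fixes X Y :: "'a :: field mat"
  assumes X: "X \<in> carrier_mat n m" and Y: "Y \<in> carrier_mat m n"
    and ev: "eigenvalue (X * Y) x" and x: "x \<noteq> 0"
  shows "eigenvalue (Y * X) x"
proof -
  obtain v where v: "v \<in> carrier_vec n" "v \<noteq> 0\<^sub>v n" and XYv: "X * Y *\<^sub>v v = x \<cdot>\<^sub>v v"
    using ev X Y by (auto simp: eigenvalue_def eigenvector_def)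
  have Yv: "Y *\<^sub>v v \<in> carrier_vec m" using Y v by simp
  have XYv': "X *\<^sub>v (Y *\<^sub>v v) = x \<cdot>\<^sub>v v" using X Y v XYv by simp
  have "Y *\<^sub>v v \<noteq> 0\<^sub>v m"
  proof
    assume "Y *\<^sub>v v = 0\<^sub>v m"
    then have xv: "x \<cdot>\<^sub>v v = 0\<^sub>v n" using XYv' X by (metis mult_mat_vec_zero)
    have "v = 0\<^sub>v n"
    proof (rule eq_vecI)
      fix i assume "i < dim_vec (0\<^sub>v n :: 'a vec)"
      then show "v $ i = 0\<^sub>v n $ i" using arg_cong[OF xv, of "\<lambda>w. w $ i"] v(1) x by simp
    qed (use v in simp)
    then show False using v by simp
  qed
  moreover have "Y * X *\<^sub>v (Y *\<^sub>v v) = x \<cdot>\<^sub>v (Y *\<^sub>v v)"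
    using XYv' X Y v Yv by (simp add: assoc_mult_mat_vec[of _ m n _ m] mult_mat_vec[of _ m n])
  ultimately show ?thesis using X Y Yv by (auto simp: eigenvalue_def eigenvector_def)
qed

text \<open>The nonzero parts of the spectra of \<open>X * Y\<close> and \<open>Y * X\<close> agree. The factors may be
  rectangular, which later turns a product with a rank-one factor into a \<open>1 \<times> 1\<close> matrix.\<close>

lemma spectral_radius_mult_commute:
  assumes X: "X \<in> carrier_mat n m" and Y: "Y \<in> carrier_mat m n" and n: "n > 0" and m: "m > 0"
  shows "spectral_radius (X * Y) = spectral_radius (Y * X)"
proof -
  have le: "spectral_radius (X * Y) \<le> spectral_radius (Y * X)"
    if X: "X \<in> carrier_mat n m" and Y: "Y \<in> carrier_mat m n" and n: "n > 0" and m: "m > 0"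
    for X Y n m
  proof -
    have XY: "X * Y \<in> carrier_mat n n" and YX: "Y * X \<in> carrier_mat m m" using X Y by auto
    obtain x where x: "eigenvalue (X * Y) x" "norm x = spectral_radius (X * Y)"
      using spectral_radius_attained[OF XY n] .
    show ?thesis
    proof (cases "x = 0")
      case True
      then show ?thesis using x(2) spectral_radius_nonneg[OF YX m] by simp
    next
      case False
      then show ?thesis
        using eigenvalue_norm_le_spectral_radius[OF YX eigenvalue_mult_commute[OF X Y x(1)]] x(2)
        by simp
    qed
  qed
  show ?thesis using le[OF X Y n m] le[OF Y X m n] by simp
qed

lemma spectral_radius_mat_1:
  assumes A: "A \<in> carrier_mat 1 1"
  shows "spectral_radius A = norm (A $$ (0, 0))"
proof -
  obtain x where x: "eigenvalue A x" "norm x = spectral_radius A"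
    using spectral_radius_attained[OF A] by auto
  obtain v where v: "v \<in> carrier_vec 1" "v \<noteq> 0\<^sub>v 1" and Av: "A *\<^sub>v v = x \<cdot>\<^sub>v v"
    using x(1) A by (auto simp: eigenvalue_def eigenvector_def)
  have "A $$ (0, 0) * v $ 0 = x * v $ 0"
    using arg_cong[OF Av, of "\<lambda>w. w $ 0"] A v(1) by (simp add: scalar_prod_def)
  moreover have "v $ 0 \<noteq> 0" using v by (auto simp: vec_eq_iff)
  ultimately show ?thesis using x(2) by simp
qed

text \<open>After division by \<open>s\<close> the spectral radius is less than 1, and the powers of such a matrix
  are bounded.\<close>

lemma spectral_radius_less_imp_growth_bound:
  assumes A: "A \<in> carrier_mat n n" and n: "n > 0" and s: "spectral_radius A < s"
  obtains c where "\<And>k. norm_bound (A ^\<^sub>m k) (c * s ^ k)"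
proof -
  have s0: "s > 0" using s spectral_radius_nonneg[OF A n] by simp
  define t where "t = complex_of_real (1 / s)"
  have t0: "t \<noteq> 0" and nt: "norm t = 1 / s" using s0 by (auto simp: t_def norm_divide)
  have tA: "t \<cdot>\<^sub>m A \<in> carrier_mat n n" using A by simp
  obtain x where x: "eigenvalue (t \<cdot>\<^sub>m A) x" "norm x = spectral_radius (t \<cdot>\<^sub>m A)"
    using spectral_radius_attained[OF tA n] .
  obtain v where v: "v \<in> carrier_vec n" "v \<noteq> 0\<^sub>v n" and tAv: "(t \<cdot>\<^sub>m A) *\<^sub>v v = x \<cdot>\<^sub>v v"
    using x(1) A by (auto simp: eigenvalue_def eigenvector_def)
  have "A *\<^sub>v v = (x / t) \<cdot>\<^sub>v v"
  proof (rule eq_vecI)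
    fix i assume i: "i < dim_vec ((x / t) \<cdot>\<^sub>v v)"
    show "(A *\<^sub>v v) $ i = ((x / t) \<cdot>\<^sub>v v) $ i"
      using arg_cong[OF tAv, of "\<lambda>w. w $ i"] i A v(1) t0 by (simp add: field_simps)
  qed (use A v in auto)
  then have "eigenvalue A (x / t)" using A v by (auto simp: eigenvalue_def eigenvector_def)
  from eigenvalue_norm_le_spectral_radius[OF A this]
  have "spectral_radius (t \<cdot>\<^sub>m A) * s \<le> spectral_radius A"
    using x(2) nt s0 by (simp add: norm_divide)
  also have "\<dots> < s" by fact
  finally have "spectral_radius (t \<cdot>\<^sub>m A) < 1" using s0 by simp
  from spectral_radius_jnf_norm_bound_less_1_upper_triangular[OF tA this]
  obtain c where c: "\<And>k. norm_bound ((t \<cdot>\<^sub>m A) ^\<^sub>m k) c" by auto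
  have pow: "(t \<cdot>\<^sub>m A) ^\<^sub>m k = t ^ k \<cdot>\<^sub>m A ^\<^sub>m k" for k
  proof (induction k)
    case 0
    show ?case using A by (auto intro!: eq_matI)
  next
    case (Suc k)
    have "A ^\<^sub>m k \<in> carrier_mat n n" using A by simp
    then show ?case using Suc A
      by (auto simp: mult_smult_assoc_mat[of _ n n _ n] mult_smult_distrib[of _ n n _ n]
          mult.assoc intro!: eq_matI)
  qed
  have "norm_bound (A ^\<^sub>m k) (c * s ^ k)" for k
  proof
    fix i j assume ij: "i < dim_row (A ^\<^sub>m k)" "j < dim_col (A ^\<^sub>m k)"
    have "norm (((t \<cdot>\<^sub>m A) ^\<^sub>m k) $$ (i, j)) \<le> c"
      using c[of k] ij unfolding norm_bound_def pow by simp
    then show "norm ((A ^\<^sub>m k) $$ (i, j)) \<le> c * s ^ k"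
      using ij s0 unfolding pow by (simp add: norm_mult norm_power nt field_simps)
  qed
  then show thesis by (rule that)
qed

lemma eigenvalue_power:
  assumes A: "A \<in> carrier_mat n n" and ev: "eigenvalue A x"
  shows "eigenvalue (A ^\<^sub>m k) (x ^ k)"
proof -
  obtain v where v: "eigenvector A v x" using ev by (auto simp: eigenvalue_def)
  then show ?thesis using eigenvector_pow[OF A v, of k] A
    by (auto simp: eigenvalue_def eigenvector_def)
qed

text \<open>On an eigenvector the powers of \<open>A\<close> act as the powers of the eigenvalue, so these grow no
  faster than the entries.\<close>

lemma eigenvalue_le_growth_rate:
  fixes A :: "complex mat"
  assumes A: "A \<in> carrier_mat n n" and ev: "eigenvalue A x"
    and bound: "\<And>k. norm_bound (A ^\<^sub>m k) (c * q ^ k)" and q: "q > 0"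
  shows "norm x \<le> q"
proof (rule ccontr)
  assume "\<not> norm x \<le> q"
  then have gt: "1 < norm x / q" using q by simp
  obtain v where v: "eigenvector A v x" using ev by (auto simp: eigenvalue_def)
  then have vc: "v \<in> carrier_vec n" and v0: "v \<noteq> 0\<^sub>v n" using A by (auto simp: eigenvector_def)
  obtain i where i: "i < n" "v $ i \<noteq> 0" using vc v0 by (auto simp: vec_eq_iff)
  define D where "D = (\<Sum>l<n. c * norm (v $ l))"
  have le: "norm (v $ i) * (norm x / q) ^ k \<le> D" for k
  proof -
    have Ak: "A ^\<^sub>m k \<in> carrier_mat n n" using A by simp
    have "x ^ k * v $ i = (A ^\<^sub>m k *\<^sub>v v) $ i"
      using eigenvector_pow[OF A v, of k] i(1) vc by simp
    also have "\<dots> = (\<Sum>l<n. (A ^\<^sub>m k) $$ (i, l) * v $ l)"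
      using A Ak i(1) vc
      by (subst index_mult_mat_vec) (auto simp: scalar_prod_def atLeast0LessThan)
    finally have "norm (x ^ k * v $ i) \<le> (\<Sum>l<n. norm ((A ^\<^sub>m k) $$ (i, l) * v $ l))"
      by (simp add: norm_sum)
    also have "\<dots> \<le> (\<Sum>l<n. c * q ^ k * norm (v $ l))"
      using bound[of k] A Ak i unfolding norm_bound_def
      by (intro sum_mono) (auto simp: norm_mult intro!: mult_right_mono)
    also have "\<dots> = D * q ^ k" unfolding D_def sum_distrib_right by (simp add: mult_ac)
    finally show ?thesis using q by (simp add: norm_mult norm_power field_simps)
  qed
  obtain k where "D / norm (v $ i) < (norm x / q) ^ k" using real_arch_pow[OF gt] by auto
  then show False using le[of k] i by (simp add: field_simps)
qed

lemma pow_mat_mult: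
  fixes A :: "'a :: semiring_1 mat"
  assumes A: "A \<in> carrier_mat n n"
  shows "(A ^\<^sub>m k) ^\<^sub>m j = A ^\<^sub>m (k * j)"
proof -
  \<comment> \<open>The variable \<open>b\<close> only fills the extension slot of the ring record.\<close>
  interpret semiring "ring_mat TYPE('a) n b" by (rule semiring_mat)
  have "A ^\<^sub>m k \<in> carrier_mat n n" using A by simp
  then show ?thesis
    using nat_pow_pow[of A k j] A by (simp add: pow_mat_ring_pow[of _ n _ b] ring_mat_simps)
qed

text \<open>For the upper bound, an intermediate rate \<open>s > \<rho>\<close> for the powers of \<open>A\<close> gives the rate \<open>s\<^bsup>k\<^esup>\<close>
  for the powers of \<open>A\<^bsup>k\<^esup>\<close>, and then \<open>s\<close> tends to \<open>\<rho>\<close>.\<close>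

lemma spectral_radius_pow:
  assumes A: "A \<in> carrier_mat n n" and n: "n > 0"
  shows "spectral_radius (A ^\<^sub>m k) = spectral_radius A ^ k"
proof (rule antisym)
  have Ak: "A ^\<^sub>m k \<in> carrier_mat n n" using A by simp
  show "spectral_radius A ^ k \<le> spectral_radius (A ^\<^sub>m k)"
  proof -
    obtain x where x: "eigenvalue A x" "norm x = spectral_radius A"
      using spectral_radius_attained[OF A n] .
    show ?thesis
      using eigenvalue_norm_le_spectral_radius[OF Ak eigenvalue_power[OF A x(1)]] x(2)
      by (simp add: norm_power)
  qed
  obtain y where y: "eigenvalue (A ^\<^sub>m k) y" "norm y = spectral_radius (A ^\<^sub>m k)"
    using spectral_radius_attained[OF Ak n] .
  have le: "norm y \<le> s ^ k" if s: "spectral_radius A < s" for s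
  proof -
    have s0: "s > 0" using s spectral_radius_nonneg[OF A n] by simp
    obtain c where c: "\<And>k. norm_bound (A ^\<^sub>m k) (c * s ^ k)"
      using spectral_radius_less_imp_growth_bound[OF A n s] by blast
    have "norm_bound ((A ^\<^sub>m k) ^\<^sub>m j) (c * (s ^ k) ^ j)" for j
      using c[of "k * j"] A by (simp add: pow_mat_mult[OF A] power_mult)
    from eigenvalue_le_growth_rate[OF Ak y(1) this] s0 show ?thesis by simp
  qed
  have "((\<lambda>s. s ^ k) \<longlongrightarrow> spectral_radius A ^ k) (at_right (spectral_radius A))"
    by (intro tendsto_intros)
  moreover have "\<forall>\<^sub>F s in at_right (spectral_radius A). norm y \<le> s ^ k"
    using le by (auto simp: eventually_at_right_less intro: eventually_at_rightI[of _ "spectral_radius A + 1"])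
  ultimately have "norm y \<le> spectral_radius A ^ k"
    by (rule tendsto_lowerbound) simp
  then show "spectral_radius (A ^\<^sub>m k) \<le> spectral_radius A ^ k" using y(2) by simp
qed

section \<open>The spectral radius of a real matrix\<close>

lemma real_spectral_radius_nonneg:
  assumes "A \<in> carrier_mat n n" and "n > 0"
  shows "0 \<le> real_spectral_radius A"
  using assms by (auto simp: real_spectral_radius_def intro: spectral_radius_nonneg)

lemma real_spectral_radius_mult_commute:
  assumes "X \<in> carrier_mat n m" and "Y \<in> carrier_mat m n" and "n > 0" and "m > 0"
  shows "real_spectral_radius (X * Y) = real_spectral_radius (Y * X)"
  unfolding real_spectral_radius_def
    of_real_hom.mat_hom_mult[OF assms(1,2)] of_real_hom.mat_hom_mult[OF assms(2,1)]
  using assms by (intro spectral_radius_mult_commute[of _ n m]) auto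

lemma real_spectral_radius_mat_1:
  assumes "A \<in> carrier_mat 1 1"
  shows "real_spectral_radius A = \<bar>A $$ (0, 0)\<bar>"
  using assms spectral_radius_mat_1[of "map_mat complex_of_real A"]
  by (simp add: real_spectral_radius_def)

lemma real_spectral_radius_pow:
  assumes "A \<in> carrier_mat n n" and "n > 0"
  shows "real_spectral_radius (A ^\<^sub>m k) = real_spectral_radius A ^ k"
  unfolding real_spectral_radius_def of_real_hom.mat_hom_pow[OF assms(1)]
  using assms by (intro spectral_radius_pow) auto

lemma real_spectral_radius_less_imp_growth_bound:
  assumes V: "V \<in> carrier_mat m n" and A: "A \<in> carrier_mat n n" and U: "U \<in> carrier_mat n l"
    and n: "n > 0" and s: "real_spectral_radius A < s"
  obtains c where "\<And>k. norm_bound (V * A ^\<^sub>m k * U) (c * s ^ k)"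
proof -
  have A': "map_mat complex_of_real A \<in> carrier_mat n n" using A by simp
  obtain c where c: "\<And>k. norm_bound (map_mat complex_of_real A ^\<^sub>m k) (c * s ^ k)"
    using spectral_radius_less_imp_growth_bound[OF A' n s[unfolded real_spectral_radius_def]] by blast
  have cA: "norm_bound (A ^\<^sub>m k) (c * s ^ k)" for k
    using c[of k] A unfolding of_real_hom.mat_hom_pow[OF A, symmetric] norm_bound_def by simp
  obtain bV bU where bV: "norm_bound V bV" and bU: "norm_bound U bU"
    using norm_bound_max by blast
  have "norm_bound (V * A ^\<^sub>m k * U) ((bV * c * n * bU * n) * s ^ k)" for k
  proof -
    have Ak: "A ^\<^sub>m k \<in> carrier_mat n n" using A by simp
    show ?thesis
      using norm_bound_mult[OF mult_carrier_mat[OF V Ak] U norm_bound_mult[OF V Ak bV cA] bU]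
      by (simp add: mult_ac)
  qed
  then show thesis by (rule that)
qed

section \<open>Matrices of rank one\<close>

text \<open>A maximal independent set of columns has a single element, and every column is a multiple
  of it.\<close>

lemma (in vec_space) rank_1_imp_factorization:
  assumes A: "A \<in> carrier_mat n nc" and rank: "rank A = 1"
  obtains U V where "U \<in> carrier_mat n 1" and "V \<in> carrier_mat 1 nc" and "A = U * V"
proof -
  have cols: "set (cols A) \<subseteq> carrier_vec n" using A cols_dim by blast
  have "lin_indpt {}" by (simp add: lin_dep_def)
  then obtain W where W: "maximal W (\<lambda>T. T \<subseteq> set (cols A) \<and> lin_indpt T)"
    using maximal_exists_superset[of "set (cols A)" "\<lambda>T. T \<subseteq> set (cols A) \<and> lin_indpt T" "{}"]
    by auto
  have "card W = 1" using rank_card_indpt[OF A W] rank by simp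
  then obtain u where Wu: "W = {u}" by (auto simp: card_1_singleton_iff)
  have u: "u \<in> carrier_vec n" and indpt: "lin_indpt {u}"
    using W cols unfolding Wu maximal_def by auto
  have col: "\<exists>c. col A j = c \<cdot>\<^sub>v u" if j: "j < nc" for j
  proof -
    have mem: "col A j \<in> set (cols A)" using j A by (auto simp: cols_def)
    have "col A j \<in> span {u}"
    proof (cases "col A j = u")
      case True
      then show ?thesis using u by (auto intro: span_mem)
    next
      case False
      have "lin_dep ({u} \<union> {col A j})"
      proof (rule ccontr)
        assume "\<not> lin_dep ({u} \<union> {col A j})"
        then have "{u} \<union> {col A j} = {u}"
          using W mem unfolding Wu maximal_def by auto
        then show False using False by auto
      qed
      then show ?thesis
        using lin_dep_iff_in_span[OF _ indpt, of "col A j"] u False A by auto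
    qed
    then obtain a T where a: "col A j = lincomb a T" "T \<subseteq> {u}" by (auto dest: in_spanE)
    then consider "T = {}" | "T = {u}" by blast
    then show ?thesis
    proof cases
      case 1
      then have "col A j = 0 \<cdot>\<^sub>v u" using a u by (auto simp: lincomb_def)
      then show ?thesis by blast
    next
      case 2
      then have "col A j = a u \<cdot>\<^sub>v u"
        using a u by (intro eq_vecI) (auto simp: lincomb_index)
      then show ?thesis by blast
    qed
  qed
  then obtain g where g: "\<And>j. j < nc \<Longrightarrow> col A j = g j \<cdot>\<^sub>v u" by metis
  define U where "U = mat n 1 (\<lambda>(i, j). u $ i)"
  define V where "V = mat 1 nc (\<lambda>(i, j). g j)"
  have "A = U * V"
  proof (rule eq_matI)
    fix i j assume "i < dim_row (U * V)" "j < dim_col (U * V)"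
    then have ij: "i < n" "j < nc" by (auto simp: U_def V_def)
    have "A $$ (i, j) = col A j $ i" using ij A by simp
    then show "A $$ (i, j) = (U * V) $$ (i, j)"
      using g[of j] ij u by (simp add: U_def V_def scalar_prod_def)
  qed (use A in \<open>auto simp: U_def V_def\<close>)
  then show thesis by (intro that[of U V]) (auto simp: U_def V_def)
qed

section \<open>Products along words\<close>

lemma word_prod_Nil [simp]: "word_prod d S [] = 1\<^sub>m d"
  by (simp add: word_prod_def)

lemma word_prod_Cons [simp]: "word_prod d S (i # w) = S i * word_prod d S w"
  by (simp add: word_prod_def)

lemma word_prod_carrier [simp]:
  assumes "\<And>i. i \<in> set w \<Longrightarrow> S i \<in> carrier_mat d d"
  shows "word_prod d S w \<in> carrier_mat d d"
  using assms by (induction w) (auto intro!: mult_carrier_mat[of _ d d])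

lemma word_prod_append:
  assumes "\<And>i. i \<in> set (u @ w) \<Longrightarrow> S i \<in> carrier_mat d d"
  shows "word_prod d S (u @ w) = word_prod d S u * word_prod d S w"
  using assms
proof (induction u)
  case Nil
  then have "word_prod d S w \<in> carrier_mat d d" by simp
  then show ?case by simp
next
  case (Cons i u)
  then have "S i \<in> carrier_mat d d" "word_prod d S u \<in> carrier_mat d d"
    "word_prod d S w \<in> carrier_mat d d" by auto
  then show ?case using Cons by (simp add: assoc_mult_mat[of _ d d _ d _ d])
qed

lemma word_prod_concat_replicate:
  assumes "\<And>i. i \<in> set w \<Longrightarrow> S i \<in> carrier_mat d d"
  shows "word_prod d S (concat (replicate k w)) = word_prod d S w ^\<^sub>m k"
proof (induction k)
  case 0
  have "word_prod d S w \<in> carrier_mat d d" using assms by simp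
  then show ?case by simp
next
  case (Suc k)
  have "concat (replicate (Suc k) w) = concat (replicate k w) @ w"
    by (induction k) auto
  moreover have "word_prod d S (concat (replicate k w) @ w) =
      word_prod d S (concat (replicate k w)) * word_prod d S w"
    using assms by (intro word_prod_append) auto
  ultimately show ?case using Suc by (simp del: replicate_Suc)
qed

lemma word_prod_replicate:
  assumes "S i \<in> carrier_mat d d"
  shows "word_prod d S (replicate k i) = S i ^\<^sub>m k"
  using word_prod_concat_replicate[of "[i]" S d k] assms by (simp add: concat_replicate_single)

text \<open>This brings a chosen letter to the front: up to rotation, every word with a letter \<open>a\<close> starts
  with \<open>a\<close>.\<close>

lemma real_spectral_radius_word_prod_rotate:
  assumes S: "\<And>i. i \<in> set (u @ w) \<Longrightarrow> S i \<in> carrier_mat d d" and d: "d > 0"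
  shows "real_spectral_radius (word_prod d S (u @ w)) =
    real_spectral_radius (word_prod d S (w @ u))"
proof -
  have c: "word_prod d S u \<in> carrier_mat d d" "word_prod d S w \<in> carrier_mat d d"
    using S by auto
  show ?thesis
  proof -
    have "word_prod d S (u @ w) = word_prod d S u * word_prod d S w"
      using S by (intro word_prod_append) auto
    moreover have "word_prod d S (w @ u) = word_prod d S w * word_prod d S u"
      using S by (intro word_prod_append) auto
    ultimately show ?thesis using real_spectral_radius_mult_commute[OF c d d] by simp
  qed
qed

lemma finite_words: "finite (words n)"
  using finite_lists_length_eq[of "{1, 2 :: nat}" n] by (simp add: words_def conj_commute)

text \<open>The powers of a word that attains the bound attain it too. They have arbitrarily large
  lengths, so the limit superior cannot be smaller than the bound.\<close>

lemma generalized_spectral_radius_eqI: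
  assumes d: "d > 0" and S: "S 1 \<in> carrier_mat d d" "S 2 \<in> carrier_mat d d" and r: "0 \<le> r"
    and le: "\<And>w. w \<noteq> [] \<Longrightarrow> set w \<subseteq> {1, 2} \<Longrightarrow>
      real_spectral_radius (word_prod d S w) \<le> r ^ length w"
    and w: "w \<noteq> []" "set w \<subseteq> {1, 2}" "real_spectral_radius (word_prod d S w) = r ^ length w"
  shows "generalized_spectral_radius d S = ereal r"
proof -
  define F where "F n = Max ((\<lambda>w. root n (real_spectral_radius (word_prod d S w))) ` words n)" for n
  have Sc: "S i \<in> carrier_mat d d" if "i \<in> {1, 2}" for i using S that by auto
  have ne: "words n \<noteq> {}" for n
    by (auto simp: words_def intro!: exI[of _ "replicate n 1"])
  have upper: "F n \<le> r" if n: "n \<ge> 1" for n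
  proof -
    have "root n (real_spectral_radius (word_prod d S u)) \<le> r" if u: "u \<in> words n" for u
    proof -
      have "real_spectral_radius (word_prod d S u) \<le> r ^ n"
        using le[of u] u n unfolding words_def by fastforce
      then have "root n (real_spectral_radius (word_prod d S u)) \<le> root n (r ^ n)"
        using n by simp
      then show ?thesis using n r by (simp add: real_root_power_cancel)
    qed
    then show ?thesis using finite_words ne by (simp add: F_def)
  qed
  have lower: "r \<le> F (j * length w)" if j: "j \<ge> 1" for j
  proof -
    let ?u = "concat (replicate j w)"
    have len: "length ?u = j * length w" by (induction j) auto
    have u: "?u \<in> words (j * length w)" using w(2) j len by (auto simp: words_def)
    have W: "word_prod d S w \<in> carrier_mat d d" using w(2) Sc by (intro word_prod_carrier) blast
    have "real_spectral_radius (word_prod d S ?u) = r ^ (j * length w)"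
      using word_prod_concat_replicate[of w S d j] w Sc
      by (simp add: real_spectral_radius_pow[OF W d] subset_iff power_mult mult.commute[of j])
    then have "root (j * length w) (real_spectral_radius (word_prod d S ?u)) = r"
      using j w(1) r by (simp add: real_root_power_cancel)
    then show ?thesis unfolding F_def using u finite_words by (intro Max_ge) force+
  qed
  have "limsup (\<lambda>n. ereal (F n)) \<le> ereal r"
    using upper by (intro Limsup_bounded) (auto simp: eventually_sequentially)
  moreover have "ereal r \<le> limsup (\<lambda>n. ereal (F n))"
    unfolding limsup_INF_SUP
  proof (rule INF_greatest)
    fix n :: nat
    have "n \<le> Suc n * length w" using w(1) by (cases w) auto
    then show "ereal r \<le> (SUP m\<in>{n..}. ereal (F m))"
      using lower[of "Suc n"] by (intro SUP_upper2[of "Suc n * length w"]) auto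
  qed
  ultimately show ?thesis
    by (simp add: generalized_spectral_radius_def F_def)
qed

section \<open>Words with a rank-one letter\<close>

lemma mat_1_mult_entry:
  assumes "X \<in> carrier_mat 1 1" and "Y \<in> carrier_mat 1 1"
  shows "(X * Y) $$ (0, 0) = X $$ (0, 0) * Y $$ (0, 0)"
  using assms by (simp add: scalar_prod_def)

text \<open>With \<open>B = S b\<close>, the first letter \<open>a\<close> of a word \<open>b\<dots>b a q\<close> splits the \<open>1 \<times> 1\<close> matrix
  \<open>V B\<^bsup>k\<^esup> A Q U\<close> into \<open>(V B\<^bsup>k\<^esup> U) (V Q U)\<close>, and induction applies to \<open>q\<close>. In the exponent, one of the two
  successors accounts for the letter \<open>a\<close> and the other one is that of the claim.\<close>

lemma rank_1_word_bound:
  assumes a: "S a = U * V" and U: "U \<in> carrier_mat d 1" and V: "V \<in> carrier_mat 1 d"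
    and B: "S b \<in> carrier_mat d d"
    and le: "\<And>k. \<bar>(V * S b ^\<^sub>m k * U) $$ (0, 0)\<bar> \<le> r ^ Suc k"
    and w: "set w \<subseteq> {a, b}"
  shows "\<bar>(V * word_prod d S w * U) $$ (0, 0)\<bar> \<le> r ^ Suc (length w)"
  using w
proof (induction "length w" arbitrary: w rule: less_induct)
  case less
  have Sc: "S i \<in> carrier_mat d d" if "i \<in> {a, b}" for i using a U V B that by auto
  show ?case
  proof (cases "a \<in> set w")
    case False
    then have "w = replicate (length w) b"
      using less.prems by (intro replicate_eqI) auto
    then have "word_prod d S w = S b ^\<^sub>m length w"
      using word_prod_replicate[of S b, OF B] by metis
    then show ?thesis using le by simp
  next
    case True
    then obtain p q where w: "w = p @ a # q" and p: "a \<notin> set p"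
      using split_list_first by metis
    have pb: "p = replicate (length p) b"
      using less.prems w p by (intro replicate_eqI) auto
    have pw: "word_prod d S p = S b ^\<^sub>m length p"
      using word_prod_replicate[of S b, OF B] pb by metis
    define Q where "Q = word_prod d S q"
    define P where "P = S b ^\<^sub>m length p"
    have Q: "Q \<in> carrier_mat d d" using less.prems w Sc unfolding Q_def
      by (intro word_prod_carrier) auto
    have P: "P \<in> carrier_mat d d" using B by (simp add: P_def)
    have "word_prod d S w = P * (U * V * Q)"
      using less.prems Sc w a by (subst w, subst word_prod_append) (auto simp: pw P_def Q_def)
    then have "V * word_prod d S w * U = (V * P * U) * (V * Q * U)"
      using U V P Q by (simp add: assoc_mult_mat[of _ 1 d _ d _ 1] assoc_mult_mat[of _ 1 d _ d _ d]
          assoc_mult_mat[of _ 1 d _ 1 _ 1] assoc_mult_mat[of _ d 1 _ d _ 1]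
          assoc_mult_mat[of _ d 1 _ d _ d] assoc_mult_mat[of _ d d _ d _ 1]
          assoc_mult_mat[of _ d d _ 1 _ 1])
    then have "\<bar>(V * word_prod d S w * U) $$ (0, 0)\<bar> =
        \<bar>(V * P * U) $$ (0, 0)\<bar> * \<bar>(V * Q * U) $$ (0, 0)\<bar>"
      using U V P Q mat_1_mult_entry[of "V * P * U" "V * Q * U"] by (simp add: abs_mult)
    also have "\<dots> \<le> r ^ Suc (length p) * r ^ Suc (length q)"
    proof (rule mult_mono)
      show "\<bar>(V * P * U) $$ (0, 0)\<bar> \<le> r ^ Suc (length p)" using le by (simp add: P_def)
      then show "0 \<le> r ^ Suc (length p)" by (rule order_trans[OF abs_ge_zero])
      show "\<bar>(V * Q * U) $$ (0, 0)\<bar> \<le> r ^ Suc (length q)"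
        using less.hyps[of q] less.prems w by (simp add: Q_def)
    qed simp
    also have "\<dots> = r ^ Suc (length w)" using w by (simp add: power_add)
    finally show ?thesis .
  qed
qed

text \<open>Moving the column \<open>U\<close> from the front to the back leaves a \<open>1 \<times> 1\<close> matrix.\<close>

lemma real_spectral_radius_rank_1_word:
  assumes a: "S a = U * V" and U: "U \<in> carrier_mat d 1" and V: "V \<in> carrier_mat 1 d"
    and W: "word_prod d S w \<in> carrier_mat d d" and d: "d > 0"
  shows "real_spectral_radius (word_prod d S (a # w)) = \<bar>(V * word_prod d S w * U) $$ (0, 0)\<bar>"
proof -
  have "word_prod d S (a # w) = U * (V * word_prod d S w)"
    using a U V W by (simp add: assoc_mult_mat[of _ d 1 _ d _ d])
  then have "real_spectral_radius (word_prod d S (a # w)) =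
      real_spectral_radius (V * word_prod d S w * U)"
    using real_spectral_radius_mult_commute[OF U _ d, of "V * word_prod d S w"] V W by simp
  then show ?thesis using real_spectral_radius_mat_1[of "V * word_prod d S w * U"] U V W by simp
qed

text \<open>If some \<open>root (k + 1) (c k)\<close> exceeds \<open>\<rho>\<close>, then by the growth bound for an intermediate rate
  \<open>s\<close> only finitely many of these roots are at least as large as that one, so there is a largest
  root. Otherwise \<open>\<rho>\<close> itself is the bound.\<close>

lemma max_root_attained:
  fixes c :: "nat \<Rightarrow> real"
  assumes \<rho>: "0 \<le> \<rho>" and c: "\<And>k. 0 \<le> c k"
    and growth: "\<And>s. \<rho> < s \<Longrightarrow> \<exists>C. \<forall>k. c k \<le> C * s ^ k"
  obtains r where "\<rho> \<le> r" and "\<And>k. c k \<le> r ^ Suc k" and "r = \<rho> \<or> (\<exists>k. c k = r ^ Suc k)"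
proof (cases "\<forall>k. c k \<le> \<rho> ^ Suc k")
  case True
  then show thesis using that[of \<rho>] by auto
next
  case False
  define f where "f k = root (Suc k) (c k)" for k
  have f0: "0 \<le> f k" for k using c[of k] by (simp add: f_def)
  have fpow: "f k ^ Suc k = c k" for k
    using c[of k] unfolding f_def by (intro real_root_pow_pos2) auto
  obtain k0 where "\<rho> ^ Suc k0 < f k0 ^ Suc k0" using False unfolding fpow not_all not_le by blast
  then have k0: "\<rho> < f k0" using f0[of k0] by (rule power_less_imp_less_base)
  obtain s where s: "\<rho> < s" "s < f k0" using dense[OF k0] by auto
  have s0: "0 < s" using s \<rho> by simp
  obtain C where C: "\<And>k. c k \<le> C * s ^ k" using growth[OF s(1)] by auto
  define K where "K = {k. f k0 \<le> f k}"
  \<comment> \<open>Roots that are at least \<open>f k0\<close> force \<open>(f k0)\<^bsup>k + 1\<^esup> \<le> C s\<^bsup>k\<^esup>\<close>, which fails once \<open>(f k0 / s)\<^bsup>k\<^esup>\<close>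
    exceeds \<open>C / f k0\<close>.\<close>
  obtain N where N: "C / f k0 < (f k0 / s) ^ N"
    using real_arch_pow[of "f k0 / s"] s s0 by auto
  have "K \<subseteq> {..N}"
  proof
    fix k assume k: "k \<in> K"
    have "f k0 ^ Suc k \<le> C * s ^ k"
      using power_mono[of "f k0" "f k" "Suc k"] k f0[of k0] fpow[of k] C[of k] by (simp add: K_def)
    then have "(f k0 / s) ^ k \<le> C / f k0"
      using s s0 by (simp add: field_simps)
    with N have "(f k0 / s) ^ k < (f k0 / s) ^ N" by simp
    then have "k < N" using s s0 by (simp add: power_strict_increasing_iff)
    then show "k \<in> {..N}" by simp
  qed
  then have fin: "finite (f ` K)" by (simp add: finite_subset)
  have k0K: "k0 \<in> K" by (simp add: K_def)
  define r where "r = Max (f ` K)"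
  have "r \<in> f ` K" unfolding r_def using fin k0K by (intro Max_in) auto
  then obtain k1 where k1: "r = f k1" by auto
  have r: "f k0 \<le> r" unfolding r_def using fin k0K by simp
  have "f k \<le> r" for k
  proof (cases "k \<in> K")
    case True
    then show ?thesis unfolding r_def using fin by simp
  qed (use r in \<open>simp add: K_def\<close>)
  then have "c k \<le> r ^ Suc k" for k
    using power_mono[of "f k" r "Suc k"] f0[of k] fpow[of k] by metis
  moreover have "\<rho> \<le> r" using r k0 by simp
  moreover have "c k1 = r ^ Suc k1" using fpow k1 by metis
  ultimately show thesis using that[of r] by blast
qed

text \<open>The bound \<open>r\<close> is the larger of \<open>\<rho> B\<close> and the largest \<open>root (k + 1) (c k)\<close>, if there is one
  above \<open>\<rho> B\<close>; the word that attains it is \<open>b\<close> or \<open>a b\<^bsup>k\<^esup>\<close> accordingly.\<close>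

lemma rank_1_pair_finiteness:
  assumes d: "d > 0" and ab: "{a, b} = {1, 2}"
    and S: "S 1 \<in> carrier_mat d d" "S 2 \<in> carrier_mat d d"
    and a: "S a = U * V" and U: "U \<in> carrier_mat d 1" and V: "V \<in> carrier_mat 1 d"
  shows "\<exists>n\<ge>1. \<exists>w\<in>words n.
    generalized_spectral_radius d S = ereal (root n (real_spectral_radius (word_prod d S w)))"
proof -
  have Sc: "S i \<in> carrier_mat d d" if "i \<in> {a, b}" for i using S ab that by auto
  then have B: "S b \<in> carrier_mat d d" by simp
  define c where "c k = \<bar>(V * S b ^\<^sub>m k * U) $$ (0, 0)\<bar>" for k
  have growth: "\<exists>C. \<forall>k. c k \<le> C * s ^ k" if s: "real_spectral_radius (S b) < s" for s
  proof -
    obtain C where C: "\<And>k. norm_bound (V * S b ^\<^sub>m k * U) (C * s ^ k)"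
      using real_spectral_radius_less_imp_growth_bound[OF V B U d s] by blast
    then have "c k \<le> C * s ^ k" for k
      using V U unfolding norm_bound_def c_def by simp
    then show ?thesis by blast
  qed
  have nonneg: "0 \<le> real_spectral_radius (S b)" using real_spectral_radius_nonneg[OF B d] .
  obtain r where r: "real_spectral_radius (S b) \<le> r" and le: "\<And>k. c k \<le> r ^ Suc k"
    and att: "r = real_spectral_radius (S b) \<or> (\<exists>k. c k = r ^ Suc k)"
    using max_root_attained[OF nonneg _ growth] by (auto simp: c_def)
  have r0: "0 \<le> r" using r nonneg by simp
  have upper: "real_spectral_radius (word_prod d S w) \<le> r ^ length w"
    if w: "set w \<subseteq> {1, 2}" for w
  proof (cases "a \<in> set w")
    case False
    then have "w = replicate (length w) b"
      using w ab by (intro replicate_eqI) auto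
    then have "word_prod d S w = S b ^\<^sub>m length w" using word_prod_replicate[of S b, OF B] by metis
    then show ?thesis using real_spectral_radius_pow[OF B d] power_mono[OF r nonneg] by simp
  next
    case True
    then obtain p q where pq: "w = p @ a # q" using split_list by metis
    have qp: "set (q @ p) \<subseteq> {a, b}" using w ab pq by auto
    have "real_spectral_radius (word_prod d S w) =
        real_spectral_radius (word_prod d S (a # q @ p))"
      using real_spectral_radius_word_prod_rotate[of p "a # q" S d] Sc qp d pq by auto
    also have "\<dots> = \<bar>(V * word_prod d S (q @ p) * U) $$ (0, 0)\<bar>"
      using qp Sc by (intro real_spectral_radius_rank_1_word[of S a, OF a U V _ d] word_prod_carrier) blast
    also have "\<dots> \<le> r ^ Suc (length (q @ p))"
      using rank_1_word_bound[of S a, OF a U V B le[unfolded c_def] qp] .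
    also have "Suc (length (q @ p)) = length w" using pq by simp
    finally show ?thesis .
  qed
  obtain w where w: "w \<noteq> []" "set w \<subseteq> {1, 2}"
    "real_spectral_radius (word_prod d S w) = r ^ length w"
    using att
  proof
    assume "r = real_spectral_radius (S b)"
    then show thesis using that[of "[b]"] ab B by auto
  next
    assume "\<exists>k. c k = r ^ Suc k"
    then obtain k where k: "c k = r ^ Suc k" by auto
    have "real_spectral_radius (word_prod d S (a # replicate k b)) = r ^ Suc k"
      using k word_prod_replicate[of S b, OF B, of k] B
        real_spectral_radius_rank_1_word[of S a, OF a U V _ d, of "replicate k b"]
      by (simp add: c_def)
    moreover have "set (a # replicate k b) \<subseteq> {1, 2}"
      unfolding ab[symmetric] by (auto simp: set_replicate_conv_if)
    ultimately show thesis using that[of "a # replicate k b"] by simp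
  qed
  have "generalized_spectral_radius d S = ereal r"
    using generalized_spectral_radius_eqI[OF d S r0 upper w] by simp
  moreover have "root (length w) (real_spectral_radius (word_prod d S w)) = r"
    using w r0 by (simp add: real_root_power_cancel)
  moreover have "w \<in> words (length w)" "length w \<ge> 1"
    using w by (auto simp: words_def Suc_le_eq)
  ultimately show ?thesis by metis
qed

theorem theorem1p3:
  fixes d :: nat and S :: "nat \<Rightarrow> real mat"
  assumes "2 \<le> d"
    and "S 1 \<in> carrier_mat d d" and "S 2 \<in> carrier_mat d d"
    and "vec_space.rank d (S 1) = 1 \<or> vec_space.rank d (S 2) = 1"
  shows "\<exists>n\<ge>1. \<exists>w\<in>words n.
    generalized_spectral_radius d S = ereal (root n (real_spectral_radius (word_prod d S w)))"
proof -
  obtain a b where ab: "{a, b} = {1, 2 :: nat}" and rank: "vec_space.rank d (S a) = 1"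
    using assms(4) by (metis insert_commute)
  have "a \<in> {1, 2}" using ab by blast
  then have "S a \<in> carrier_mat d d" using assms(2,3) by blast
  then obtain U V where "U \<in> carrier_mat d 1" "V \<in> carrier_mat 1 d" "S a = U * V"
    using rank by (rule vec_space.rank_1_imp_factorization)
  then show ?thesis using rank_1_pair_finiteness[OF _ ab assms(2,3)] assms(1) by simp
qed

end
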